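(* Let $f\colon X\to Y$ be a morphism in a category $C$, regarded also as an object of the slice category $C/Y$. Then: (1) $f$ is a split epimorphism if and only if $\pi_0((C/Y)/f)$ is trivial; (2) $f$ is a monomorphism if and only if $\pi_1((C/Y)/f)$ is trivial; (3) $f$ is an isomorphism if and only if both $\pi_0((C/Y)/f)$ and $\pi_1((C/Y)/f)$ are trivial.
   Context: A pointed poset is trivial if its basepoint is its only element. Composition is written in diagrammatic order: $f;g$ means first $f$, then $g$. Poset reflection: for a category $C$, $\|C\|$ is the poset whose elements are equivalence classes $\|x\|$ of objects $x$ of $C$, with $\|x\|=\|y\|$ iff there exist morphisms $x\to y$ and $y\to x$, and $\|x\|\le\|y\|$ iff there exists a morphism $x\to y$ in $C$. This is functorial in $C$. Zeroth homotopy poset: for an object $x$ of a category $C$, the functor $\mathrm{dom}\colon C/x\to C$ from the slice category induces an order-preserving map $\|\mathrm{dom}\|\colon \|C/x\|\to\|C\|$. The pointed poset $(\pi_0(C/x),[x])$ is the quotient of $\|C\|$ by this map, i.e. the pushout in the category of posets of $\|\mathrm{dom}\|$ along the unique map $\|C/x\|\to 1$ to the one-element poset, pointed with the image $[x]$ of the element of $1$. Explicitly, an element of $\pi_0(C/x)$ is either $[x]$, or $\|y\|$ for an object $y$ such that there is no morphism $y\to x$; the order is: $[x]\le[x]$; $[x]\le\|y\|$ iff there is a span $x\leftarrow z\to y$ in $C$; never $\|y\|\le[x]$; and $\|y\|\le\|z\|$ iff there is a morphism $y\to z$. Category of parallel arrows: $\mathrm{Par}(C/x)$ has as objects the pairs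 $(f_0,f_1\colon y\to x)$ of parallel morphisms with codomain $x$; a morphism $(f_0,f_1\colon y\to x)\to(g_0,g_1\colon z\to x)$ is a morphism $h\colon y\to z$ with $f_0=h;g_0$ and $f_1=h;g_1$. First homotopy poset: $(\pi_1(C/x),[x])$ is the pointed poset $\bigl(\pi_0(\mathrm{Par}(C/x)/(\mathrm{id}_x,\mathrm{id}_x)),[(\mathrm{id}_x,\mathrm{id}_x)]\bigr)$, i.e. the zeroth homotopy poset of the category $\mathrm{Par}(C/x)$ over its object $(\mathrm{id}_x,\mathrm{id}_x)$. In the claim, $\pi_i((C/Y)/f)$ is the $i$-th homotopy poset of the category $C/Y$ over its object $f$. *)

theory Defs
  imports "HOL-Algebra.Order"
begin

section \<open>Categories\<close>

text \<open>\<open>cmp\<close> is composition in diagrammatic order: \<open>cmp C f g\<close> is first \<open>f\<close>, then \<open>g\<close>.\<close>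

record ('o, 'm) cat =
  Ob :: "'o set"
  Mor :: "'m set"
  src :: "'m \<Rightarrow> 'o"
  tgt :: "'m \<Rightarrow> 'o"
  idm :: "'o \<Rightarrow> 'm"
  cmp :: "'m \<Rightarrow> 'm \<Rightarrow> 'm"

definition hom :: "('o, 'm) cat \<Rightarrow> 'o \<Rightarrow> 'o \<Rightarrow> 'm set" where
  "hom C x y = {f \<in> Mor C. src C f = x \<and> tgt C f = y}"

locale category =
  fixes C :: "('o, 'm) cat"
  assumes src_closed: "f \<in> Mor C \<Longrightarrow> src C f \<in> Ob C"
    and tgt_closed: "f \<in> Mor C \<Longrightarrow> tgt C f \<in> Ob C"
    and idm_hom: "x \<in> Ob C \<Longrightarrow> idm C x \<in> hom C x x"
    and cmp_hom: "f \<in> hom C x y \<Longrightarrow> g \<in> hom C y z \<Longrightarrow> cmp C f g \<in> hom C x z"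
    and idm_left: "f \<in> hom C x y \<Longrightarrow> cmp C (idm C x) f = f"
    and idm_right: "f \<in> hom C x y \<Longrightarrow> cmp C f (idm C y) = f"
    and cmp_assoc: "f \<in> hom C w x \<Longrightarrow> g \<in> hom C x y \<Longrightarrow> h \<in> hom C y z \<Longrightarrow>
      cmp C (cmp C f g) h = cmp C f (cmp C g h)"

definition split_epi :: "('o, 'm) cat \<Rightarrow> 'm \<Rightarrow> bool" where
  "split_epi C f \<longleftrightarrow> f \<in> Mor C \<and>
    (\<exists>s \<in> hom C (tgt C f) (src C f). cmp C s f = idm C (tgt C f))"

definition mono_mor :: "('o, 'm) cat \<Rightarrow> 'm \<Rightarrow> bool" where
  "mono_mor C f \<longleftrightarrow> f \<in> Mor C \<and>
    (\<forall>z \<in> Ob C. \<forall>g \<in> hom C z (src C f). \<forall>h \<in> hom C z (src C f).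
      cmp C g f = cmp C h f \<longrightarrow> g = h)"

definition iso_mor :: "('o, 'm) cat \<Rightarrow> 'm \<Rightarrow> bool" where
  "iso_mor C f \<longleftrightarrow> f \<in> Mor C \<and>
    (\<exists>g \<in> hom C (tgt C f) (src C f).
      cmp C f g = idm C (src C f) \<and> cmp C g f = idm C (tgt C f))"

text \<open>
  The same morphism of \<open>C\<close> may underlie several morphisms of a slice, so a morphism of
  \<open>slice C x\<close> is a triple (source object, underlying morphism of \<open>C\<close>, target object); likewise
  for \<open>par C x\<close>.
\<close>

definition slice :: "('o, 'm) cat \<Rightarrow> 'o \<Rightarrow> ('m, 'm \<times> 'm \<times> 'm) cat" where
  "slice C x = \<lparr>
     Ob = {f \<in> Mor C. tgt C f = x},
     Mor = {(f, h, g). f \<in> Mor C \<and> tgt C f = x \<and> g \<in> Mor C \<and> tgt C g = x \<and>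
              h \<in> hom C (src C f) (src C g) \<and> f = cmp C h g},
     src = (\<lambda>(f, h, g). f),
     tgt = (\<lambda>(f, h, g). g),
     idm = (\<lambda>f. (f, idm C (src C f), f)),
     cmp = (\<lambda>(f, h, g) (f', h', g'). (f, cmp C h h', g')) \<rparr>"

definition par_pairs :: "('o, 'm) cat \<Rightarrow> 'o \<Rightarrow> ('m \<times> 'm) set" where
  "par_pairs C x = {(f0, f1). f0 \<in> Mor C \<and> f1 \<in> Mor C \<and>
     src C f0 = src C f1 \<and> tgt C f0 = x \<and> tgt C f1 = x}"

definition par :: "('o, 'm) cat \<Rightarrow> 'o \<Rightarrow> ('m \<times> 'm, ('m \<times> 'm) \<times> 'm \<times> ('m \<times> 'm)) cat" where
  "par C x = \<lparr>
     Ob = par_pairs C x,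
     Mor = {(f, h, g). f \<in> par_pairs C x \<and> g \<in> par_pairs C x \<and>
              h \<in> hom C (src C (fst f)) (src C (fst g)) \<and>
              fst f = cmp C h (fst g) \<and> snd f = cmp C h (snd g)},
     src = (\<lambda>(f, h, g). f),
     tgt = (\<lambda>(f, h, g). g),
     idm = (\<lambda>f. (f, idm C (src C (fst f)), f)),
     cmp = (\<lambda>(f, h, g) (f', h', g'). (f, cmp C h h', g')) \<rparr>"


section \<open>Poset reflection and homotopy posets\<close>

definition refl_class :: "('o, 'm) cat \<Rightarrow> 'o \<Rightarrow> 'o set" where
  "refl_class C x = {y \<in> Ob C. hom C x y \<noteq> {} \<and> hom C y x \<noteq> {}}"

definition poset_reflection :: "('o, 'm) cat \<Rightarrow> 'o set gorder" where
  "poset_reflection C = \<lparr>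
     carrier = refl_class C ` Ob C,
     eq = (=),
     le = (\<lambda>A B. \<exists>a \<in> A. \<exists>b \<in> B. hom C a b \<noteq> {}) \<rparr>"

record 'a pointed_order = "'a gorder" +
  point :: 'a

definition trivial_pointed :: "'a pointed_order \<Rightarrow> bool" where
  "trivial_pointed P \<longleftrightarrow> carrier P = {point P}"

text \<open>
  In \<open>pi0 C x\<close>, the value \<open>None\<close> is the basepoint \<open>[x]\<close>, and \<open>Some A\<close> is the class \<open>A\<close> of an
  object without morphisms to \<open>x\<close>. That this explicit poset is the pushout of
  \<open>\<parallel>dom\<parallel> : \<parallel>C/x\<parallel> \<rightarrow> \<parallel>C\<parallel>\<close> along \<open>\<parallel>C/x\<parallel> \<rightarrow> 1\<close> is proved in \<open>pi0_cocone\<close> and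
  \<open>pi0_universal\<close> below.
\<close>

definition pi0 :: "('o, 'm) cat \<Rightarrow> 'o \<Rightarrow> 'o set option pointed_order" where
  "pi0 C x = \<lparr>
     carrier = insert None (Some ` {refl_class C y | y. y \<in> Ob C \<and> hom C y x = {}}),
     eq = (=),
     le = (\<lambda>p q. case (p, q) of
        (None, None) \<Rightarrow> True
      | (None, Some B) \<Rightarrow> \<exists>y \<in> B. \<exists>z \<in> Ob C. hom C z x \<noteq> {} \<and> hom C z y \<noteq> {}
      | (Some A, None) \<Rightarrow> False
      | (Some A, Some B) \<Rightarrow> A \<sqsubseteq>\<^bsub>poset_reflection C\<^esub> B),
     point = None \<rparr>"

definition pi1 :: "('o, 'm) cat \<Rightarrow> 'o \<Rightarrow> ('m \<times> 'm) set option pointed_order" where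
  "pi1 C x = pi0 (par C x) (idm C x, idm C x)"


section \<open>Well-definedness\<close>

lemma partial_orderI_eq:
  fixes L (structure)
  assumes eq: "(.=) = (=)"
    and "\<And>x. x \<in> carrier L \<Longrightarrow> x \<sqsubseteq> x"
    and "\<And>x y. x \<sqsubseteq> y \<Longrightarrow> y \<sqsubseteq> x \<Longrightarrow> x \<in> carrier L \<Longrightarrow> y \<in> carrier L \<Longrightarrow> x = y"
    and "\<And>x y z. x \<sqsubseteq> y \<Longrightarrow> y \<sqsubseteq> z \<Longrightarrow>
      x \<in> carrier L \<Longrightarrow> y \<in> carrier L \<Longrightarrow> z \<in> carrier L \<Longrightarrow> x \<sqsubseteq> z"
  shows "partial_order L"
  by unfold_locales (use assms in \<open>(simp add: eq; fail) | (unfold eq; blast)\<close>)+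

lemma hom_slice:
  "(f, h, g) \<in> hom (slice C x) f' g' \<longleftrightarrow> f' = f \<and> g' = g \<and> f \<in> Mor C \<and> tgt C f = x \<and>
     g \<in> Mor C \<and> tgt C g = x \<and> h \<in> hom C (src C f) (src C g) \<and> f = cmp C h g"
  by (auto simp: hom_def slice_def)

lemma hom_par:
  "(f, h, g) \<in> hom (par C x) f' g' \<longleftrightarrow> f' = f \<and> g' = g \<and> f \<in> par_pairs C x \<and>
     g \<in> par_pairs C x \<and> h \<in> hom C (src C (fst f)) (src C (fst g)) \<and>
     fst f = cmp C h (fst g) \<and> snd f = cmp C h (snd g)"
  by (auto simp: hom_def par_def)

context category
begin

lemma Mor_hom: "f \<in> Mor C \<Longrightarrow> f \<in> hom C (src C f) (tgt C f)"
  by (simp add: hom_def)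

lemma category_slice: "category (slice C x)"
proof
  fix f assume "f \<in> Mor (slice C x)"
  then show "src (slice C x) f \<in> Ob (slice C x)" and "tgt (slice C x) f \<in> Ob (slice C x)"
    by (auto simp: slice_def)
next
  fix f assume "f \<in> Ob (slice C x)"
  then have f: "f \<in> Mor C" "tgt C f = x" by (auto simp: slice_def)
  have "(f, idm C (src C f), f) \<in> hom (slice C x) f f"
    using f idm_hom[OF src_closed] idm_left[OF Mor_hom] by (auto simp: hom_slice)
  then show "idm (slice C x) f \<in> hom (slice C x) f f" by (simp add: slice_def)
next
  fix F a b G c assume F: "F \<in> hom (slice C x) a b" and G: "G \<in> hom (slice C x) b c"
  obtain h where h: "F = (a, h, b)" using F by (cases F) (auto simp: hom_slice)
  obtain k where k: "G = (b, k, c)" using G by (cases G) (auto simp: hom_slice)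
  have "(a, cmp C h k, c) \<in> hom (slice C x) a c"
    using F G unfolding h k hom_slice
    by (metis cmp_hom cmp_assoc Mor_hom)
  then show "cmp (slice C x) F G \<in> hom (slice C x) a c"
    by (simp add: h k slice_def)
next
  fix F a b assume F: "F \<in> hom (slice C x) a b"
  obtain h where h: "F = (a, h, b)" using F by (cases F) (auto simp: hom_slice)
  show "cmp (slice C x) (idm (slice C x) a) F = F"
    using F idm_left unfolding h hom_slice by (auto simp: slice_def)
  show "cmp (slice C x) F (idm (slice C x) b) = F"
    using F idm_right unfolding h hom_slice by (auto simp: slice_def)
next
  fix F G H a b c d
  assume F: "F \<in> hom (slice C x) a b" and G: "G \<in> hom (slice C x) b c"
    and H: "H \<in> hom (slice C x) c d"
  obtain h where h: "F = (a, h, b)" using F by (cases F) (auto simp: hom_slice)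
  obtain k where k: "G = (b, k, c)" using G by (cases G) (auto simp: hom_slice)
  obtain l where l: "H = (c, l, d)" using H by (cases H) (auto simp: hom_slice)
  have "cmp C (cmp C h k) l = cmp C h (cmp C k l)"
    using F G H unfolding h k l hom_slice by (blast intro: cmp_assoc)
  then show "cmp (slice C x) (cmp (slice C x) F G) H = cmp (slice C x) F (cmp (slice C x) G H)"
    by (simp add: h k l slice_def)
qed

lemma category_par: "category (par C x)"
proof
  fix f assume "f \<in> Mor (par C x)"
  then show "src (par C x) f \<in> Ob (par C x)" and "tgt (par C x) f \<in> Ob (par C x)"
    by (auto simp: par_def)
next
  fix f assume "f \<in> Ob (par C x)"
  then have f: "f \<in> par_pairs C x" by (simp add: par_def)
  then have fM: "fst f \<in> Mor C" "snd f \<in> Mor C" "src C (snd f) = src C (fst f)"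
    by (auto simp: par_pairs_def)
  have "(f, idm C (src C (fst f)), f) \<in> hom (par C x) f f"
    using f fM idm_hom[OF src_closed] idm_left[OF Mor_hom[OF fM(1)]] idm_left[OF Mor_hom[OF fM(2)]]
    by (auto simp: hom_par)
  then show "idm (par C x) f \<in> hom (par C x) f f" by (simp add: par_def)
next
  fix F a b G c assume F: "F \<in> hom (par C x) a b" and G: "G \<in> hom (par C x) b c"
  obtain h where h: "F = (a, h, b)" using F by (cases F) (auto simp: hom_par)
  obtain k where k: "G = (b, k, c)" using G by (cases G) (auto simp: hom_par)
  have c: "fst c \<in> hom C (src C (fst c)) x" "snd c \<in> hom C (src C (fst c)) x"
    using G unfolding k hom_par by (auto simp: par_pairs_def hom_def)
  have "(a, cmp C h k, c) \<in> hom (par C x) a c"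
    using F G unfolding h k hom_par
    by (metis cmp_hom cmp_assoc c)
  then show "cmp (par C x) F G \<in> hom (par C x) a c"
    by (simp add: h k par_def)
next
  fix F a b assume F: "F \<in> hom (par C x) a b"
  obtain h where h: "F = (a, h, b)" using F by (cases F) (auto simp: hom_par)
  show "cmp (par C x) (idm (par C x) a) F = F"
    using F idm_left unfolding h hom_par by (auto simp: par_def)
  show "cmp (par C x) F (idm (par C x) b) = F"
    using F idm_right unfolding h hom_par by (auto simp: par_def)
next
  fix F G H a b c d
  assume F: "F \<in> hom (par C x) a b" and G: "G \<in> hom (par C x) b c"
    and H: "H \<in> hom (par C x) c d"
  obtain h where h: "F = (a, h, b)" using F by (cases F) (auto simp: hom_par)
  obtain k where k: "G = (b, k, c)" using G by (cases G) (auto simp: hom_par)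
  obtain l where l: "H = (c, l, d)" using H by (cases H) (auto simp: hom_par)
  have "cmp C (cmp C h k) l = cmp C h (cmp C k l)"
    using F G H unfolding h k l hom_par by (blast intro: cmp_assoc)
  then show "cmp (par C x) (cmp (par C x) F G) H = cmp (par C x) F (cmp (par C x) G H)"
    by (simp add: h k l par_def)
qed

lemma hom_nonempty_refl: "x \<in> Ob C \<Longrightarrow> hom C x x \<noteq> {}"
  using idm_hom by blast

lemma hom_nonempty_trans: "hom C x y \<noteq> {} \<Longrightarrow> hom C y z \<noteq> {} \<Longrightarrow> hom C x z \<noteq> {}"
  using cmp_hom by blast

lemma mem_refl_class: "x \<in> Ob C \<Longrightarrow> x \<in> refl_class C x"
  by (simp add: refl_class_def hom_nonempty_refl)

lemma refl_classD:
  assumes "y \<in> refl_class C x"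
  shows "hom C x y \<noteq> {}" and "hom C y x \<noteq> {}"
  using assms by (simp_all add: refl_class_def)

lemma refl_class_eq_iff:
  assumes x: "x \<in> Ob C" and y: "y \<in> Ob C"
  shows "refl_class C x = refl_class C y \<longleftrightarrow> hom C x y \<noteq> {} \<and> hom C y x \<noteq> {}"
proof
  assume "refl_class C x = refl_class C y"
  then have "y \<in> refl_class C x" using mem_refl_class[OF y] by simp
  then show "hom C x y \<noteq> {} \<and> hom C y x \<noteq> {}" by (simp add: refl_class_def)
next
  assume h: "hom C x y \<noteq> {} \<and> hom C y x \<noteq> {}"
  have "z \<in> refl_class C x \<longleftrightarrow> z \<in> refl_class C y" for z
    using h hom_nonempty_trans[of x y z] hom_nonempty_trans[of y x z]
      hom_nonempty_trans[of z x y] hom_nonempty_trans[of z y x]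
    unfolding refl_class_def mem_Collect_eq by argo
  then show "refl_class C x = refl_class C y" by blast
qed

lemma poset_reflection_le_iff:
  "x \<in> Ob C \<Longrightarrow> y \<in> Ob C \<Longrightarrow>
    refl_class C x \<sqsubseteq>\<^bsub>poset_reflection C\<^esub> refl_class C y \<longleftrightarrow> hom C x y \<noteq> {}"
  unfolding poset_reflection_def gorder.simps
  by (meson mem_refl_class refl_classD hom_nonempty_trans)

lemma partial_order_poset_reflection: "partial_order (poset_reflection C)"
proof (rule partial_orderI_eq)
  let ?P = "poset_reflection C"
  have car: "carrier ?P = refl_class C ` Ob C" by (simp add: poset_reflection_def)
  show "eq ?P = (=)" by (simp add: poset_reflection_def)
  show "A \<sqsubseteq>\<^bsub>?P\<^esub> A" if "A \<in> carrier ?P" for A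
    using that by (auto simp only: car image_iff poset_reflection_le_iff hom_nonempty_refl)
  show "A = B" if AB: "A \<sqsubseteq>\<^bsub>?P\<^esub> B" "B \<sqsubseteq>\<^bsub>?P\<^esub> A" "A \<in> carrier ?P" "B \<in> carrier ?P" for A B
  proof -
    obtain a b where "a \<in> Ob C" "b \<in> Ob C" "A = refl_class C a" "B = refl_class C b"
      using AB unfolding car by blast
    with AB show ?thesis by (simp add: poset_reflection_le_iff refl_class_eq_iff)
  qed
  show "A \<sqsubseteq>\<^bsub>?P\<^esub> D" if ABD: "A \<sqsubseteq>\<^bsub>?P\<^esub> B" "B \<sqsubseteq>\<^bsub>?P\<^esub> D"
    "A \<in> carrier ?P" "B \<in> carrier ?P" "D \<in> carrier ?P" for A B D
  proof -
    obtain a b d where "a \<in> Ob C" "b \<in> Ob C" "d \<in> Ob C"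
      "A = refl_class C a" "B = refl_class C b" "D = refl_class C d"
      using ABD unfolding car by blast
    with ABD hom_nonempty_trans[of a b d] show ?thesis by (simp add: poset_reflection_le_iff)
  qed
qed

lemma pi0_simps:
  "carrier (pi0 C x) = insert None (Some ` {refl_class C y | y. y \<in> Ob C \<and> hom C y x = {}})"
  "eq (pi0 C x) = (=)"
  "point (pi0 C x) = None"
  "None \<sqsubseteq>\<^bsub>pi0 C x\<^esub> None"
  "\<not> Some A \<sqsubseteq>\<^bsub>pi0 C x\<^esub> None"
  "Some A \<sqsubseteq>\<^bsub>pi0 C x\<^esub> Some B \<longleftrightarrow> A \<sqsubseteq>\<^bsub>poset_reflection C\<^esub> B"
  by (simp_all add: pi0_def)

lemma pi0_point_le_iff:
  "y \<in> Ob C \<Longrightarrow>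
    None \<sqsubseteq>\<^bsub>pi0 C x\<^esub> Some (refl_class C y) \<longleftrightarrow> (\<exists>z \<in> Ob C. hom C z x \<noteq> {} \<and> hom C z y \<noteq> {})"
  unfolding pi0_def gorder.simps prod.case option.case
  by (meson mem_refl_class refl_classD hom_nonempty_trans)

lemma partial_order_pi0: "partial_order (pi0 C x)"
proof (rule partial_orderI_eq)
  let ?P = "pi0 C x"
  interpret R: partial_order "poset_reflection C" by (rule partial_order_poset_reflection)
  have Some_car: "A \<in> carrier (poset_reflection C)" if "Some A \<in> carrier ?P" for A
    using that by (auto simp: pi0_simps poset_reflection_def)
  show "eq ?P = (=)" by (rule pi0_simps)
  show "p \<sqsubseteq>\<^bsub>?P\<^esub> p" if "p \<in> carrier ?P" for p
    using that Some_car R.le_refl by (cases p) (auto simp only: pi0_simps(4-))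
  show "p = q" if "p \<sqsubseteq>\<^bsub>?P\<^esub> q" "q \<sqsubseteq>\<^bsub>?P\<^esub> p" "p \<in> carrier ?P" "q \<in> carrier ?P" for p q
  proof (cases p)
    case None
    with that(2) show ?thesis by (cases q) (simp_all add: pi0_simps(4-))
  next
    case (Some A)
    with that(1) obtain B where B: "q = Some B" by (cases q) (simp_all add: pi0_simps(4-))
    have "A = B"
      using that Some_car unfolding Some B pi0_simps(6) by (intro R.le_antisym)
    with Some B show ?thesis by simp
  qed
  show "p \<sqsubseteq>\<^bsub>?P\<^esub> r" if pqr: "p \<sqsubseteq>\<^bsub>?P\<^esub> q" "q \<sqsubseteq>\<^bsub>?P\<^esub> r"
    "p \<in> carrier ?P" "q \<in> carrier ?P" "r \<in> carrier ?P" for p q r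
  proof (cases p)
    case (Some A)
    then obtain B where B: "q = Some B" using pqr(1) by (cases q) (simp_all add: pi0_simps(4-))
    then obtain D where D: "r = Some D" using pqr(2) by (cases r) (simp_all add: pi0_simps(4-))
    show ?thesis using pqr Some_car R.le_trans[of A B D] unfolding Some B D pi0_simps(6) by simp
  next
    case None
    show ?thesis
    proof (cases q)
      case None
      with pqr(2) \<open>p = None\<close> show ?thesis by simp
    next
      case (Some B)
      then obtain D where D: "r = Some D" using pqr(2) by (cases r) (simp_all add: pi0_simps(4-))
      obtain b where b: "b \<in> Ob C" "B = refl_class C b"
        using pqr(4) unfolding Some pi0_simps by blast
      obtain d where d: "d \<in> Ob C" "D = refl_class C d"
        using pqr(5) unfolding D pi0_simps by blast
      have "hom C b d \<noteq> {}"
        using pqr(2) b d unfolding Some D by (simp add: pi0_simps(6) poset_reflection_le_iff)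
      moreover obtain z where "z \<in> Ob C" "hom C z x \<noteq> {}" "hom C z b \<noteq> {}"
        using pqr(1) b(1) unfolding None Some b(2) pi0_point_le_iff[OF b(1)] by blast
      ultimately have "\<exists>z \<in> Ob C. hom C z x \<noteq> {} \<and> hom C z d \<noteq> {}"
        using hom_nonempty_trans by blast
      then show ?thesis unfolding \<open>p = None\<close> D d(2) pi0_point_le_iff[OF d(1)] .
    qed
  qed
qed

end

text \<open>
  \<open>refl_map D F\<close> is the map \<open>\<parallel>F\<parallel>\<close> into \<open>\<parallel>D\<parallel>\<close> induced by a functor with object part \<open>F\<close>; the
  domain functor \<open>slice C x \<rightarrow> C\<close> has object part \<open>src C\<close>. The map \<open>pi0_proj\<close> is the leg
  \<open>\<parallel>C\<parallel> \<rightarrow> \<pi>\<^sub>0(C/x)\<close> of the pushout cocone.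
\<close>

definition refl_map :: "('p, 'n) cat \<Rightarrow> ('o \<Rightarrow> 'p) \<Rightarrow> 'o set \<Rightarrow> 'p set" where
  "refl_map D F A = (\<Union>a \<in> A. refl_class D (F a))"

definition pi0_proj :: "('o, 'm) cat \<Rightarrow> 'o \<Rightarrow> 'o set \<Rightarrow> 'o set option" where
  "pi0_proj C x A = (if \<exists>a \<in> A. hom C a x \<noteq> {} then None else Some A)"

context category
begin

lemma refl_map_dom:
  assumes f: "f \<in> Ob (slice C x)"
  shows "refl_map C (src C) (refl_class (slice C x) f) = refl_class C (src C f)"
proof -
  interpret S: category "slice C x" by (rule category_slice)
  have "refl_class C (src C g) = refl_class C (src C f)" if g: "g \<in> refl_class (slice C x) f" for g
  proof -
    have "hom C (src C f) (src C g) \<noteq> {}" "hom C (src C g) (src C f) \<noteq> {}"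
      using g by (auto simp: refl_class_def hom_slice)
    moreover have "src C f \<in> Ob C" "src C g \<in> Ob C"
      using f g src_closed by (auto simp: refl_class_def slice_def)
    ultimately show ?thesis by (simp add: refl_class_eq_iff)
  qed
  moreover have "f \<in> refl_class (slice C x) f"
    using f S.hom_nonempty_refl by (simp add: refl_class_def)
  ultimately show ?thesis unfolding refl_map_def by blast
qed

lemma pi0_proj_class:
  assumes "y \<in> Ob C"
  shows "pi0_proj C x (refl_class C y) = (if hom C y x \<noteq> {} then None else Some (refl_class C y))"
proof -
  have "(\<exists>a \<in> refl_class C y. hom C a x \<noteq> {}) \<longleftrightarrow> hom C y x \<noteq> {}"
    using assms by (meson mem_refl_class refl_classD hom_nonempty_trans)
  then show ?thesis by (simp only: pi0_proj_def)
qed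

theorem pi0_cocone:
  assumes x: "x \<in> Ob C"
  shows "pi0_proj C x \<in> carrier (poset_reflection C) \<rightarrow> carrier (pi0 C x)"
    and "isotone (poset_reflection C) (pi0 C x) (pi0_proj C x)"
    and "A \<in> carrier (poset_reflection (slice C x)) \<Longrightarrow>
      pi0_proj C x (refl_map C (src C) A) = point (pi0 C x)"
proof -
  have car: "carrier (poset_reflection C) = refl_class C ` Ob C"
    by (simp add: poset_reflection_def)
  show "pi0_proj C x \<in> carrier (poset_reflection C) \<rightarrow> carrier (pi0 C x)"
  proof
    fix A assume "A \<in> carrier (poset_reflection C)"
    then obtain y where y: "y \<in> Ob C" "A = refl_class C y" unfolding car by blast
    show "pi0_proj C x A \<in> carrier (pi0 C x)"
      using y unfolding y(2) pi0_proj_class[OF y(1)] pi0_simps(1) by (cases "hom C y x = {}") auto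
  qed
  show "isotone (poset_reflection C) (pi0 C x) (pi0_proj C x)"
  proof (rule isotoneI)
    show "weak_partial_order (poset_reflection C)" "weak_partial_order (pi0 C x)"
      using partial_order_poset_reflection partial_order_pi0
      by (simp_all add: partial_order_def)
    fix A B assume "A \<in> carrier (poset_reflection C)" "B \<in> carrier (poset_reflection C)"
      and le: "A \<sqsubseteq>\<^bsub>poset_reflection C\<^esub> B"
    then obtain a b where ab: "a \<in> Ob C" "b \<in> Ob C" "A = refl_class C a" "B = refl_class C b"
      unfolding car by blast
    with le have h: "hom C a b \<noteq> {}" by (simp add: poset_reflection_le_iff)
    show "pi0_proj C x A \<sqsubseteq>\<^bsub>pi0 C x\<^esub> pi0_proj C x B"
    proof (cases "hom C b x = {}")
      case True
      show ?thesis
      proof (cases "hom C a x = {}")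
        case True
        with \<open>hom C b x = {}\<close> le show ?thesis
          unfolding ab(3,4) pi0_proj_class[OF ab(1)] pi0_proj_class[OF ab(2)]
          by (simp add: pi0_simps(6))
      next
        case False
        then have "None \<sqsubseteq>\<^bsub>pi0 C x\<^esub> Some (refl_class C b)"
          using ab(1) h unfolding pi0_point_le_iff[OF ab(2)] by blast
        with False \<open>hom C b x = {}\<close> show ?thesis
          unfolding ab(3,4) pi0_proj_class[OF ab(1)] pi0_proj_class[OF ab(2)] by simp
      qed
    next
      case False
      with hom_nonempty_trans[OF h False] show ?thesis
        unfolding ab(3,4) pi0_proj_class[OF ab(1)] pi0_proj_class[OF ab(2)]
        by (simp add: pi0_simps(4))
    qed
  qed
  show "pi0_proj C x (refl_map C (src C) A) = point (pi0 C x)"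
    if A: "A \<in> carrier (poset_reflection (slice C x))"
  proof -
    obtain f where f: "f \<in> Ob (slice C x)" "A = refl_class (slice C x) f"
      using A by (auto simp: poset_reflection_def)
    then have "src C f \<in> Ob C" "f \<in> hom C (src C f) x"
      using src_closed by (auto simp: slice_def hom_def)
    then show ?thesis using f by (auto simp: refl_map_dom pi0_proj_class pi0_simps)
  qed
qed

theorem pi0_universal:
  fixes Q :: "('q, 'r) gorder_scheme"
  assumes x: "x \<in> Ob C" and Q: "partial_order Q"
    and g: "g \<in> carrier (poset_reflection C) \<rightarrow> carrier Q" "isotone (poset_reflection C) Q g"
    and p: "p \<in> carrier Q"
    and gp: "\<And>A. A \<in> carrier (poset_reflection (slice C x)) \<Longrightarrow> g (refl_map C (src C) A) = p"
  shows "\<exists>!u. u \<in> carrier (pi0 C x) \<rightarrow>\<^sub>E carrier Q \<and> isotone (pi0 C x) Q u \<and>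
    u (point (pi0 C x)) = p \<and> (\<forall>A \<in> carrier (poset_reflection C). u (pi0_proj C x A) = g A)"
proof -
  interpret Q: partial_order Q by (rule Q)
  have car: "carrier (poset_reflection C) = refl_class C ` Ob C"
    by (simp add: poset_reflection_def)
  have gx: "g (refl_class C y) = p" if y: "y \<in> Ob C" "hom C y x \<noteq> {}" for y
  proof -
    obtain f where "f \<in> hom C y x" using y by blast
    then have f: "f \<in> Ob (slice C x)" "src C f = y" by (auto simp: slice_def hom_def)
    then show ?thesis using gp[of "refl_class (slice C x) f"] refl_map_dom[OF f(1)]
      by (simp add: poset_reflection_def)
  qed
  have gle: "g (refl_class C y) \<sqsubseteq>\<^bsub>Q\<^esub> g (refl_class C z)"
    if "y \<in> Ob C" "z \<in> Ob C" "hom C y z \<noteq> {}" for y z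
    using g(2) that by (simp add: isotone_def car poset_reflection_le_iff)
  let ?v = "\<lambda>q. case q of None \<Rightarrow> p | Some A \<Rightarrow> g A"
  let ?u = "restrict ?v (carrier (pi0 C x))"
  have vle: "?v q \<sqsubseteq>\<^bsub>Q\<^esub> ?v r"
    if q: "q \<in> carrier (pi0 C x)" and r: "r \<in> carrier (pi0 C x)" and le: "q \<sqsubseteq>\<^bsub>pi0 C x\<^esub> r" for q r
  proof (cases q)
    case None
    show ?thesis
    proof (cases r)
      case None
      with \<open>q = None\<close> p show ?thesis by simp
    next
      case (Some B)
      then obtain y where y: "y \<in> Ob C" "B = refl_class C y" using r unfolding pi0_simps by blast
      with le \<open>q = None\<close> Some obtain z where
        z: "z \<in> Ob C" "hom C z x \<noteq> {}" "hom C z y \<noteq> {}"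
        by (auto simp: pi0_point_le_iff)
      then show ?thesis using gle[OF z(1) y(1) z(3)] gx[OF z(1,2)] None Some y by simp
    qed
  next
    case (Some A)
    then obtain B where B: "r = Some B" using le by (cases r) (auto simp: pi0_simps)
    obtain a b where "a \<in> Ob C" "A = refl_class C a" "b \<in> Ob C" "B = refl_class C b"
      using q r unfolding Some B pi0_simps by blast
    with le Some B gle show ?thesis by (simp add: pi0_simps(6) poset_reflection_le_iff)
  qed
  show ?thesis
  proof (rule ex1I)
    show "?u \<in> carrier (pi0 C x) \<rightarrow>\<^sub>E carrier Q \<and> isotone (pi0 C x) Q ?u \<and>
      ?u (point (pi0 C x)) = p \<and> (\<forall>A \<in> carrier (poset_reflection C). ?u (pi0_proj C x A) = g A)"
    proof (intro conjI)
      show "?u \<in> carrier (pi0 C x) \<rightarrow>\<^sub>E carrier Q"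
        using g(1) p by (auto simp: pi0_simps car)
      show "isotone (pi0 C x) Q ?u"
        using vle partial_order_pi0 Q by (auto simp: isotone_def partial_order_def)
      show "?u (point (pi0 C x)) = p" by (simp add: pi0_simps)
      show "\<forall>A \<in> carrier (poset_reflection C). ?u (pi0_proj C x A) = g A"
        using gx by (auto simp: car pi0_proj_class pi0_simps)
    qed
  next
    fix u assume u: "u \<in> carrier (pi0 C x) \<rightarrow>\<^sub>E carrier Q \<and> isotone (pi0 C x) Q u \<and>
      u (point (pi0 C x)) = p \<and> (\<forall>A \<in> carrier (poset_reflection C). u (pi0_proj C x A) = g A)"
    show "u = ?u"
    proof (rule ext)
      fix q
      show "u q = ?u q"
      proof (cases "q \<in> carrier (pi0 C x)")
        case False
        with u show ?thesis by (auto simp: PiE_def extensional_def)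
      next
        case True
        then consider "q = None" | y where "y \<in> Ob C" "hom C y x = {}" "q = Some (refl_class C y)"
          by (auto simp: pi0_simps)
        then show ?thesis
        proof cases
          case 1
          with u True show ?thesis by (simp add: pi0_simps)
        next
          case 2
          with u have "u (pi0_proj C x (refl_class C y)) = g (refl_class C y)" by (simp add: car)
          with 2 True show ?thesis by (simp add: pi0_proj_class)
        qed
      qed
    qed
  qed
qed

end

end

theory Submission
  imports Defs
begin

text \<open>
  \<open>\<pi>\<^sub>0(C/x)\<close> is trivial iff \<open>x\<close> is weakly terminal, and \<open>\<pi>\<^sub>1(C/x)\<close> is trivial iff \<open>x\<close> is
  subterminal. In \<open>C/Y\<close>, the object \<open>f\<close> is weakly terminal iff the identity of \<open>Y\<close> factors
  through \<open>f\<close>, and subterminal iff \<open>f\<close> is right-cancellable.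
\<close>

lemma Ob_par: "Ob (par C x) = par_pairs C x"
  by (simp add: par_def)

text \<open>Besides the basepoint \<open>None\<close>, the carrier has one element for each class of
  objects that admit no morphism to \<open>x\<close>, so triviality means that there are no such
  objects.\<close>

lemma trivial_pi0_iff: "trivial_pointed (pi0 C x) \<longleftrightarrow> (\<forall>y \<in> Ob C. hom C y x \<noteq> {})"
  by (auto simp: trivial_pointed_def pi0_def)

context category
begin

text \<open>A morphism \<open>h\<close> to the pair of identities satisfies \<open>g0 = h;id\<close>
  and \<open>g1 = h;id\<close>, which forces both legs to equal \<open>h\<close>; conversely, if the
  legs agree, \<open>g0\<close> itself is such an \<open>h\<close>.\<close>

lemma hom_par_diagonal_nonempty_iff:
  assumes x: "x \<in> Ob C" and g: "(g0, g1) \<in> par_pairs C x"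
  shows "hom (par C x) (g0, g1) (idm C x, idm C x) \<noteq> {} \<longleftrightarrow> g0 = g1"
proof -
  have ix: "idm C x \<in> Mor C" "src C (idm C x) = x" "tgt C (idm C x) = x"
    using idm_hom[OF x] by (auto simp: hom_def)
  have g0: "g0 \<in> hom C (src C g0) x" using g by (auto simp: par_pairs_def hom_def)
  show ?thesis
  proof
    assume "hom (par C x) (g0, g1) (idm C x, idm C x) \<noteq> {}"
    then show "g0 = g1" by (auto simp: hom_par)
  next
    assume "g0 = g1"
    then have "((g0, g1), g0, (idm C x, idm C x)) \<in> hom (par C x) (g0, g1) (idm C x, idm C x)"
      using g g0 ix idm_right[OF g0] by (simp add: hom_par par_pairs_def)
    then show "hom (par C x) (g0, g1) (idm C x, idm C x) \<noteq> {}" by blast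
  qed
qed

lemma trivial_pi1_iff:
  assumes x: "x \<in> Ob C"
  shows "trivial_pointed (pi1 C x) \<longleftrightarrow>
    (\<forall>y \<in> Ob C. \<forall>g \<in> hom C y x. \<forall>h \<in> hom C y x. g = h)"
proof -
  have "trivial_pointed (pi1 C x) \<longleftrightarrow> (\<forall>(g, h) \<in> par_pairs C x. g = h)"
    unfolding pi1_def trivial_pi0_iff Ob_par
    by (intro ball_cong refl)
      (auto simp only: split_paired_all hom_par_diagonal_nonempty_iff[OF x] prod.case)
  also have "\<dots> \<longleftrightarrow> (\<forall>y \<in> Ob C. \<forall>g \<in> hom C y x. \<forall>h \<in> hom C y x. g = h)"
    using src_closed by (fastforce simp: par_pairs_def hom_def)
  finally show ?thesis .
qed

lemma split_epi_iff_trivial_pi0: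
  assumes f: "f \<in> hom C X Y"
  shows "split_epi C f \<longleftrightarrow> trivial_pointed (pi0 (slice C Y) f)"
proof -
  have f': "f \<in> Mor C" "src C f = X" "tgt C f = Y" using f by (auto simp: hom_def)
  have Y: "Y \<in> Ob C" using tgt_closed f' by blast
  \<comment> \<open>The outer entries of a slice morphism are fixed by its ends, so only the
    underlying arrow remains to be found.\<close>
  have hom_f: "hom (slice C Y) g f \<noteq> {} \<longleftrightarrow> (\<exists>h \<in> hom C (src C g) X. g = cmp C h f)"
    if "g \<in> Ob (slice C Y)" for g
    using that f' by (auto simp: hom_def slice_def)
  show ?thesis
  proof
    assume "split_epi C f"
    then obtain s where s: "s \<in> hom C Y X" "cmp C s f = idm C Y"
      by (auto simp: split_epi_def f')
    have "hom (slice C Y) g f \<noteq> {}" if g: "g \<in> Ob (slice C Y)" for g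
    proof -
      have g': "g \<in> hom C (src C g) Y" using g by (auto simp: slice_def hom_def)
      \<comment> \<open>A section of \<open>f\<close> lets every arrow into \<open>Y\<close> factor
        through \<open>f\<close>.\<close>
      have "g = cmp C (cmp C g s) f"
        using cmp_assoc[OF g' s(1) f] s(2) idm_right[OF g'] by simp
      then show ?thesis using hom_f[OF g] cmp_hom[OF g' s(1)] by blast
    qed
    then show "trivial_pointed (pi0 (slice C Y) f)" by (simp add: trivial_pi0_iff)
  next
    assume triv: "trivial_pointed (pi0 (slice C Y) f)"
    \<comment> \<open>Testing on the identity of \<open>Y\<close> suffices: its factorization
      through \<open>f\<close> is a section.\<close>
    have iY: "idm C Y \<in> Ob (slice C Y)" "src C (idm C Y) = Y"
      using idm_hom[OF Y] by (auto simp: slice_def hom_def)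
    then obtain s where "s \<in> hom C Y X" "idm C Y = cmp C s f"
      using triv hom_f[OF iY(1)] by (auto simp: trivial_pi0_iff)
    then show "split_epi C f" using f' by (auto simp: split_epi_def)
  qed
qed

text \<open>Two morphisms from \<open>g\<close> to \<open>f\<close> in \<open>C/Y\<close> are two
  arrows whose composites with \<open>f\<close> both equal \<open>g\<close>; their equality is
  exactly cancellation of \<open>f\<close>.\<close>

lemma mono_iff_trivial_pi1:
  assumes f: "f \<in> hom C X Y"
  shows "mono_mor C f \<longleftrightarrow> trivial_pointed (pi1 (slice C Y) f)"
proof -
  interpret S: category "slice C Y" by (rule category_slice)
  have f': "f \<in> Mor C" "src C f = X" "tgt C f = Y" using f by (auto simp: hom_def)
  then have fO: "f \<in> Ob (slice C Y)" by (simp add: slice_def)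
  show ?thesis unfolding S.trivial_pi1_iff[OF fO]
  proof
    assume mono: "mono_mor C f"
    show "\<forall>g \<in> Ob (slice C Y). \<forall>h \<in> hom (slice C Y) g f. \<forall>k \<in> hom (slice C Y) g f. h = k"
    proof (intro ballI)
      fix g h k assume h: "h \<in> hom (slice C Y) g f" and k: "k \<in> hom (slice C Y) g f"
      obtain h' where h': "h = (g, h', f)" using h by (cases h) (auto simp: hom_slice)
      obtain k' where k': "k = (g, k', f)" using k by (cases k) (auto simp: hom_slice)
      have "h' \<in> hom C (src C g) X" "k' \<in> hom C (src C g) X" "src C g \<in> Ob C"
        "cmp C h' f = cmp C k' f"
        using h k f' src_closed unfolding h' k' hom_slice by auto
      then show "h = k" using mono f'(2) unfolding h' k' mono_mor_def by blast
    qed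
  next
    assume sub: "\<forall>g \<in> Ob (slice C Y). \<forall>h \<in> hom (slice C Y) g f. \<forall>k \<in> hom (slice C Y) g f. h = k"
    have "h = k" if h: "h \<in> hom C z X" and k: "k \<in> hom C z X"
      and eq: "cmp C h f = cmp C k f" for z h k
    proof -
      \<comment> \<open>The common composite is the object of \<open>C/Y\<close> from which
        \<open>h\<close> and \<open>k\<close> become parallel morphisms to \<open>f\<close>.\<close>
      let ?g = "cmp C h f"
      have g: "?g \<in> Mor C" "src C ?g = z" "tgt C ?g = Y"
        using cmp_hom[OF h f] by (auto simp: hom_def)
      then have "?g \<in> Ob (slice C Y)" by (simp add: slice_def)
      moreover have "(?g, h, f) \<in> hom (slice C Y) ?g f" "(?g, k, f) \<in> hom (slice C Y) ?g f"
        using g f' h k eq by (simp_all add: hom_slice)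
      ultimately show ?thesis using sub by blast
    qed
    then show "mono_mor C f" using f' by (auto simp: mono_mor_def)
  qed
qed

text \<open>This reduces the criterion for isomorphisms to the other two.\<close>

lemma iso_iff_split_epi_mono:
  assumes f: "f \<in> hom C X Y"
  shows "iso_mor C f \<longleftrightarrow> split_epi C f \<and> mono_mor C f"
proof -
  have f': "f \<in> Mor C" "src C f = X" "tgt C f = Y" using f by (auto simp: hom_def)
  have X: "X \<in> Ob C" using src_closed f' by blast
  show ?thesis
  proof
    assume iso: "iso_mor C f"
    then obtain s where s: "s \<in> hom C Y X" "cmp C f s = idm C X" "cmp C s f = idm C Y"
      by (auto simp: iso_mor_def f')
    have "h = k" if h: "h \<in> hom C z X" and k: "k \<in> hom C z X"
      and eq: "cmp C h f = cmp C k f" for z h k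
    proof -
      have "h = cmp C (cmp C h f) s" using cmp_assoc[OF h f s(1)] s(2) idm_right[OF h] by simp
      also have "\<dots> = cmp C (cmp C k f) s" by (simp only: eq)
      also have "\<dots> = k" using cmp_assoc[OF k f s(1)] s(2) idm_right[OF k] by simp
      finally show ?thesis .
    qed
    then show "split_epi C f \<and> mono_mor C f"
      using s f' by (auto simp: split_epi_def mono_mor_def)
  next
    assume "split_epi C f \<and> mono_mor C f"
    then obtain s where s: "s \<in> hom C Y X" "cmp C s f = idm C Y" and mono: "mono_mor C f"
      by (auto simp: split_epi_def f')
    \<comment> \<open>Both sides equal \<open>f\<close>; cancelling the mono \<open>f\<close> turns
      its section \<open>s\<close> into a two-sided inverse.\<close>
    have "cmp C (cmp C f s) f = cmp C (idm C X) f"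
      by (simp only: cmp_assoc[OF f s(1) f] s(2) idm_left[OF f] idm_right[OF f])
    then have "cmp C f s = idm C X"
      using mono X cmp_hom[OF f s(1)] idm_hom[OF X] f' by (simp add: mono_mor_def)
    then show "iso_mor C f" using s f' by (auto simp: iso_mor_def)
  qed
qed

end

theorem corollary2:
  fixes C :: "('o, 'm) cat" and X Y :: 'o and f :: 'm
  assumes "category C" and "f \<in> hom C X Y"
  shows "(split_epi C f \<longleftrightarrow> trivial_pointed (pi0 (slice C Y) f)) \<and>
    (mono_mor C f \<longleftrightarrow> trivial_pointed (pi1 (slice C Y) f)) \<and>
    (iso_mor C f \<longleftrightarrow> trivial_pointed (pi0 (slice C Y) f) \<and> trivial_pointed (pi1 (slice C Y) f))"
proof -
  interpret category C by fact
  show ?thesis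
    using split_epi_iff_trivial_pi0[OF assms(2)] mono_iff_trivial_pi1[OF assms(2)]
      iso_iff_split_epi_mono[OF assms(2)]
    by blast
qed

end
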